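(* Let $\phi:\mathbb{R}^n\to\overline{\mathbb{R}}$ be a proper lower semicontinuous function bounded from below, let $a,b>0$, and let $\{x^k\}_{k\ge 0}\subset\mathbb{R}^n$ be a sequence such that for each $k\in\mathbb{N}$ one has $\phi(x^{k+1})+a\|x^{k+1}-x^k\|^2\le\phi(x^k)$, and there exists $w^{k+1}\in\partial\phi(x^{k+1})$ with $\|w^{k+1}\|\le b\|x^{k+1}-x^k\|$. Let $\bar x\in\mathrm{dom}\,\phi$ be an accumulation point of $\{x^k\}$ such that, for some subsequence, $x^{k_j}\to\bar x$ and $\phi(x^{k_j})\to\phi(\bar x)$ as $j\to\infty$. Suppose that $\phi$ satisfies the exponent PLK condition at $\bar x$ with $\varphi(t)=Mt^{1-q}$ for some $M>0$ and $q\in[0,1)$. Then: (i) If $q=0$, the sequence $\{\phi(x^k)\}$ terminates at $\phi(\bar x)$ in finitely many steps. (ii) If $q\in(0,\frac12)$, then either $\{\phi(x^k)\}$ terminates at $\phi(\bar x)$ in finitely many steps, or $\{\phi(x^k)\}$ converges superlinearly to $\phi(\bar x)$ as $k\to\infty$. (iii) If $q=\frac12$, then $\{\phi(x^k)\}$ converges linearly to $\phi(\bar x)$ as $k\to\infty$. (iv) If $q\in(\frac12,1)$, then there exists a constant $\eta>0$ such that $\phi(x^k)-\phi(\bar x)\le\eta\,k^{-\frac{1}{2q-1}}$ for all large $k\in\mathbb{N}$.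
   Context: $\overline{\mathbb{R}}:=\mathbb{R}\cup\{\infty\}$, $\mathrm{dom}\,\phi:=\{x\mid\phi(x)<\infty\}$, $\mathbb{N}:=\{1,2,\ldots\}$, $\mathrm{dist}(0,\emptyset):=\infty$. For $x\in\mathrm{dom}\,\phi$, the regular subdifferential $\widehat\partial\phi(x)$ is the set of $v\in\mathbb{R}^n$ with $\liminf_{u\to x,\,u\ne x}\frac{\phi(u)-\phi(x)-\langle v,u-x\rangle}{\|u-x\|}\ge 0$, and the limiting (Mordukhovich) subdifferential is $$\partial\phi(x):=\{v\in\mathbb{R}^n\mid \exists\, x_k\to x,\ \phi(x_k)\to\phi(x),\ v_k\in\widehat\partial\phi(x_k),\ v_k\to v\};$$ both sets are empty if $x\notin\mathrm{dom}\,\phi$. Exponent PLK condition at $\bar x\in\mathrm{dom}\,\phi$ with $\varphi(t)=Mt^{1-q}$ ($M>0$, $q\in[0,1)$): there exist $\eta_0\in(0,\infty)$ and a neighborhood $U$ of $\bar x$ such that $$M(1-q)\big(\phi(x)-\phi(\bar x)\big)^{-q}\,\mathrm{dist}\big(0,\partial\phi(x)\big)\ge 1\quad\text{for all }x\in U\text{ with }\phi(\bar x)<\phi(x)<\phi(\bar x)+\eta_0.$$ Terminology: $\{\phi(x^k)\}$ terminates at $\phi(\bar x)$ in finitely many steps if $\phi(x^k)=\phi(\bar x)$ for all large $k$. It converges superlinearly to $\phi(\bar x)$ if $\phi(x^k)\to\phi(\bar x)$, $\phi(x^k)\neq\phi(\bar x)$ for all $k$, and $\frac{\phi(x^{k+1})-\phi(\bar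 x)}{\phi(x^k)-\phi(\bar x)}\to 0$. It converges linearly to $\phi(\bar x)$ if there is $c\in(0,1)$ with $|\phi(x^{k+1})-\phi(\bar x)|\le c\,|\phi(x^k)-\phi(\bar x)|$ for all large $k$. *)

theory Defs
  imports "HOL-Analysis.Analysis"
begin

text \<open>Extended-real-valued functions take values in \<^typ>\<open>ereal\<close>; the value
  \<open>-\<infinity>\<close> is excluded by properness.\<close>

definition edom :: "('a \<Rightarrow> ereal) \<Rightarrow> 'a set" where
  "edom \<phi> = {x. \<phi> x < \<infinity>}"

definition proper_fun :: "('a \<Rightarrow> ereal) \<Rightarrow> bool" where
  "proper_fun \<phi> \<longleftrightarrow> (\<forall>x. \<phi> x \<noteq> -\<infinity>) \<and> edom \<phi> \<noteq> {}"

definition lower_semicontinuous :: "('a::topological_space \<Rightarrow> ereal) \<Rightarrow> bool" where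
  "lower_semicontinuous \<phi> \<longleftrightarrow> (\<forall>x. \<phi> x \<le> Liminf (at x) \<phi>)"

definition bounded_from_below :: "('a \<Rightarrow> ereal) \<Rightarrow> bool" where
  "bounded_from_below \<phi> \<longleftrightarrow> (\<exists>m::real. \<forall>x. ereal m \<le> \<phi> x)"

definition regular_subdiff :: "('a::euclidean_space \<Rightarrow> ereal) \<Rightarrow> 'a \<Rightarrow> 'a set" where
  "regular_subdiff \<phi> x =
    {v. x \<in> edom \<phi> \<and>
        0 \<le> Liminf (at x) (\<lambda>u. (\<phi> u - \<phi> x - ereal (v \<bullet> (u - x))) / ereal (norm (u - x)))}"

definition limiting_subdiff :: "('a::euclidean_space \<Rightarrow> ereal) \<Rightarrow> 'a \<Rightarrow> 'a set" where
  "limiting_subdiff \<phi> x =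
    {v. x \<in> edom \<phi> \<and>
        (\<exists>xs vs. xs \<longlonglongrightarrow> x \<and> (\<lambda>k. \<phi> (xs k)) \<longlonglongrightarrow> \<phi> x \<and>
                 (\<forall>k. vs k \<in> regular_subdiff \<phi> (xs k)) \<and> vs \<longlonglongrightarrow> v)}"

text \<open>Unlike \<^const>\<open>infdist\<close>, this distance to the empty set is \<open>\<infinity>\<close>.\<close>

definition edist_set :: "'a::metric_space \<Rightarrow> 'a set \<Rightarrow> ereal" where
  "edist_set x A = (INF y\<in>A. ereal (dist x y))"

text \<open>The desingularizing function is \<open>t \<mapsto> M * t powr (1 - q)\<close>, with derivative
  \<open>M * (1 - q) * t powr (-q)\<close>. The difference \<open>\<phi> x - \<phi> xbar\<close> is finite and positive
  wherever \<^const>\<open>real_of_ereal\<close> is applied to it.\<close>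

definition exponent_PLK ::
    "('a::euclidean_space \<Rightarrow> ereal) \<Rightarrow> 'a \<Rightarrow> real \<Rightarrow> real \<Rightarrow> bool" where
  "exponent_PLK \<phi> xbar M q \<longleftrightarrow>
    (\<exists>\<eta>\<^sub>0::real. \<eta>\<^sub>0 > 0 \<and> (\<exists>U. open U \<and> xbar \<in> U \<and>
      (\<forall>x\<in>U. \<phi> xbar < \<phi> x \<and> \<phi> x < \<phi> xbar + ereal \<eta>\<^sub>0 \<longrightarrow>
        1 \<le> ereal (M * (1 - q) * real_of_ereal (\<phi> x - \<phi> xbar) powr (- q))
              * edist_set 0 (limiting_subdiff \<phi> x))))"

definition terminates_at :: "(nat \<Rightarrow> 'a) \<Rightarrow> 'a \<Rightarrow> bool" where
  "terminates_at s L \<longleftrightarrow> (\<forall>\<^sub>F k in sequentially. s k = L)"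

text \<open>The indices of a sequence range over \<open>1, 2, \<dots>\<close>: the term \<open>s 0\<close> is unconstrained.\<close>

definition converges_superlinearly :: "(nat \<Rightarrow> ereal) \<Rightarrow> ereal \<Rightarrow> bool" where
  "converges_superlinearly s L \<longleftrightarrow>
    s \<longlonglongrightarrow> L \<and> (\<forall>k\<ge>1. s k \<noteq> L) \<and>
    (\<lambda>k. (s (Suc k) - L) / (s k - L)) \<longlonglongrightarrow> 0"

definition converges_linearly :: "(nat \<Rightarrow> ereal) \<Rightarrow> ereal \<Rightarrow> bool" where
  "converges_linearly s L \<longleftrightarrow>
    (\<exists>c::real. 0 < c \<and> c < 1 \<and>
      (\<forall>\<^sub>F k in sequentially. \<bar>s (Suc k) - L\<bar> \<le> ereal c * \<bar>s k - L\<bar>))"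

end

theory Submission
  imports Defs
begin

text \<open>
  Write \<open>\<delta> k = \<phi> (x k) - \<phi> xbar\<close> and \<open>d k = norm (x (k + 1) - x k)\<close>. Sufficient decrease makes
  \<open>\<phi> (x k)\<close> nonincreasing, so convergence along one subsequence already forces \<open>\<delta> k \<ge> 0\<close> and
  \<open>\<delta> k \<longlonglongrightarrow> 0\<close>. If \<open>\<delta>\<close> vanishes once, it vanishes from then on and every claim is trivial; the
  interest lies in the case \<open>\<delta> k > 0\<close>.

  The PLK inequality only speaks about points near \<open>xbar\<close>, while a priori only a subsequence
  approaches \<open>xbar\<close>. The bridge is a Lyapunov function. For an iterate near \<open>xbar\<close>,
  concavity of \<open>t \<mapsto> M * t powr (1 - q)\<close>, the PLK inequality and sufficient decrease give
  \<open>2 * d k \<le> d (k - 1) + (b / a) * (\<psi> k - \<psi> (k + 1))\<close> with \<open>\<psi> k = M * \<delta> k powr (1 - q)\<close>. Hence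
  \<open>dist (x k) xbar + d (k - 1) + (b / a) * \<psi> k\<close> does not increase as long as the iterates
  stay near \<open>xbar\<close>; it is small at some late member of the subsequence and bounds the
  distance to \<open>xbar\<close>, so from that index on no iterate leaves the neighbourhood
  (lemma \<open>PLK_iterates_trapped\<close>).

  From then on the PLK inequality says \<open>\<delta> (k + 1) powr q \<le> M * (1 - q) * b * d k\<close>. Squaring and
  bounding \<open>d k\<^sup>2\<close> by sufficient decrease leaves one scalar recursion
  \<open>\<delta> (k + 1) powr (2 * q) \<le> K * (\<delta> k - \<delta> (k + 1))\<close> (lemma \<open>PLK_scalar_recursion\<close>). The four cases of
  the theorem are its four regimes: for \<open>q = 0\<close> the left side is 1 while the right side tends
  to 0, a contradiction; for \<open>2 * q < 1\<close> the ratio \<open>\<delta> (k + 1) / \<delta> k\<close> is at most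
  \<open>K * \<delta> (k + 1) powr (1 - 2 * q)\<close>; for \<open>2 * q = 1\<close> it is at most \<open>K / (1 + K)\<close>; and for
  \<open>2 * q > 1\<close> the recursion is a discrete form of \<open>\<delta>' = - \<delta> powr (2 * q) / K\<close>, whose solutions
  decay like \<open>k powr (- 1 / (2 * q - 1))\<close>.
\<close>

section \<open>Tangent inequalities for real powers\<close>

lemma powr_concave_tangent:
  fixes u v \<theta> :: real
  assumes "0 < u" "u \<le> v" "0 \<le> \<theta>" "\<theta> \<le> 1"
  shows "\<theta> * v powr (\<theta> - 1) * (v - u) \<le> v powr \<theta> - u powr \<theta>"
proof (cases "u = v")
  case False
  with assms have "u < v" by simp
  moreover have "((\<lambda>t. t powr \<theta>) has_real_derivative \<theta> * t powr (\<theta> - 1)) (at t)"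
    if "u \<le> t" "t \<le> v" for t
    using assms that by (auto intro!: derivative_eq_intros)
  ultimately obtain t where t: "u < t" "t < v"
    and eq: "v powr \<theta> - u powr \<theta> = (v - u) * (\<theta> * t powr (\<theta> - 1))"
    using MVT2[of u v "\<lambda>t. t powr \<theta>" "\<lambda>t. \<theta> * t powr (\<theta> - 1)"] by blast
  have "v powr (\<theta> - 1) \<le> t powr (\<theta> - 1)"
    using assms t by (intro powr_mono2') auto
  then have "(v - u) * (\<theta> * v powr (\<theta> - 1)) \<le> (v - u) * (\<theta> * t powr (\<theta> - 1))"
    using assms by (intro mult_left_mono) auto
  then show ?thesis unfolding eq by (simp add: mult_ac)
qed simp

lemma powr_minus_convex_tangent:
  fixes u v \<alpha> :: real
  assumes "0 < u" "u \<le> v" "0 \<le> \<alpha>"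
  shows "u powr (- \<alpha>) - v powr (- \<alpha>) \<le> \<alpha> * u powr (- \<alpha> - 1) * (v - u)"
proof (cases "u = v")
  case False
  with assms have "u < v" by simp
  moreover have "((\<lambda>t. t powr (- \<alpha>)) has_real_derivative (- \<alpha>) * t powr (- \<alpha> - 1)) (at t)"
    if "u \<le> t" "t \<le> v" for t
    using assms that by (auto intro!: derivative_eq_intros)
  ultimately obtain t where t: "u < t" "t < v"
    and eq: "v powr (- \<alpha>) - u powr (- \<alpha>) = (v - u) * ((- \<alpha>) * t powr (- \<alpha> - 1))"
    using MVT2[of u v "\<lambda>t. t powr (- \<alpha>)" "\<lambda>t. (- \<alpha>) * t powr (- \<alpha> - 1)"] by blast
  have "t powr (- \<alpha> - 1) \<le> u powr (- \<alpha> - 1)"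
    using assms t by (intro powr_mono2') auto
  then have "(v - u) * (\<alpha> * t powr (- \<alpha> - 1)) \<le> (v - u) * (\<alpha> * u powr (- \<alpha> - 1))"
    using assms by (intro mult_left_mono) auto
  then show ?thesis using eq by (simp add: mult_ac)
qed simp

section \<open>Iterates are trapped near the accumulation point\<close>

text \<open>One step of the Lyapunov argument. The gradient bound in the PLK inequality involves the
  previous step length \<open>d\<close> whereas sufficient decrease involves the current one \<open>e\<close>, so
  \<open>e\<^sup>2\<close> is bounded by a product, which the inequality of arithmetic and geometric means splits.\<close>

lemma PLK_step_length:
  fixes a b M q s t d e :: real
  assumes "0 < a" "0 < b" "0 < M" "0 \<le> q" "q < 1" "0 < t" "0 \<le> d" "0 \<le> e"
    and desc: "t + a * e\<^sup>2 \<le> s"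
    and PLK: "1 \<le> M * (1 - q) * s powr (- q) * (b * d)"
  shows "2 * e \<le> d + b / a * (M * s powr (1 - q) - M * t powr (1 - q))"
proof -
  define \<Delta> where "\<Delta> = b / a * (M * s powr (1 - q) - M * t powr (1 - q))"
  define G where "G = M * (1 - q) * s powr (- q)"
  have "0 \<le> a * e\<^sup>2" using assms by simp
  with desc have ts: "t \<le> s" by linarith
  have tangent: "G * (s - t) \<le> M * s powr (1 - q) - M * t powr (1 - q)"
    using mult_left_mono[OF powr_concave_tangent[of t s "1 - q"], of M] assms ts
    by (simp add: G_def algebra_simps)
  have "a * e\<^sup>2 \<le> (s - t) * 1" using desc by simp
  also have "\<dots> \<le> (s - t) * (G * (b * d))"
    using PLK ts unfolding G_def by (intro mult_left_mono) auto
  also have "\<dots> = (b * d) * (G * (s - t))" by simp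
  also have "\<dots> \<le> (b * d) * (M * s powr (1 - q) - M * t powr (1 - q))"
    using tangent assms by (intro mult_left_mono) auto
  also have "\<dots> = a * (d * \<Delta>)" using \<open>0 < a\<close> by (simp add: \<Delta>_def)
  finally have "e\<^sup>2 \<le> d * \<Delta>" using \<open>0 < a\<close> by simp
  moreover have "4 * (d * \<Delta>) \<le> (d + \<Delta>)\<^sup>2"
    using zero_le_power2[of "d - \<Delta>"] by (simp add: power2_eq_square algebra_simps)
  ultimately have "(2 * e)\<^sup>2 \<le> (d + \<Delta>)\<^sup>2" by (simp add: power_mult_distrib)
  moreover have "0 \<le> \<Delta>"
  proof -
    have "t powr (1 - q) \<le> s powr (1 - q)"
      using assms ts by (intro powr_mono2) auto
    then show ?thesis using assms unfolding \<Delta>_def by simp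
  qed
  ultimately show ?thesis
    using assms unfolding \<Delta>_def[symmetric] by (intro power2_le_imp_le[of "2 * e"]) auto
qed

text \<open>Sufficient decrease makes the step lengths tend to zero, so the Lyapunov function
  \<open>dist (x (k + 1)) xbar + d k + (b / a) * \<psi> (k + 1)\<close> is below the radius at a suitable index,
  and its monotonicity inside the ball keeps it there. The PLK inequality needs \<open>\<delta>\<close> to be
  small as well, which holds for all late indices and is absorbed into the
  hypothesis \<open>PLK\<close>.\<close>

lemma PLK_iterates_trapped:
  fixes x :: "nat \<Rightarrow> 'a::real_normed_vector" and \<delta> :: "nat \<Rightarrow> real"
  assumes "0 < a" "0 < b" "0 < M" "0 \<le> q" "q < 1"
    and pos: "\<forall>\<^sub>F k in sequentially. 0 < \<delta> k"
    and lim: "\<delta> \<longlonglongrightarrow> 0"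
    and desc: "\<forall>\<^sub>F k in sequentially. \<delta> (Suc k) + a * (norm (x (Suc k) - x k))\<^sup>2 \<le> \<delta> k"
    and PLK: "\<forall>\<^sub>F k in sequentially. x (Suc k) \<in> ball xbar \<rho> \<longrightarrow>
      1 \<le> M * (1 - q) * \<delta> (Suc k) powr (- q) * (b * norm (x (Suc k) - x k))"
    and acc: "\<And>\<epsilon>. 0 < \<epsilon> \<Longrightarrow> \<exists>\<^sub>F k in sequentially. dist (x k) xbar < \<epsilon>"
    and "0 < \<rho>"
  shows "\<forall>\<^sub>F k in sequentially. x k \<in> ball xbar \<rho>"
proof -
  define d where "d = (\<lambda>k. norm (x (Suc k) - x k))"
  define V where "V = (\<lambda>k. d k + b / a * (M * \<delta> (Suc k) powr (1 - q)))"
  have d_lim: "d \<longlonglongrightarrow> 0"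
  proof -
    have "(\<lambda>k. (\<delta> k - \<delta> (Suc k)) / a) \<longlonglongrightarrow> (0 - 0) / a"
      using lim \<open>0 < a\<close> by (intro tendsto_intros LIMSEQ_Suc) auto
    then have upper: "(\<lambda>k. (\<delta> k - \<delta> (Suc k)) / a) \<longlonglongrightarrow> 0" by simp
    have "(\<lambda>k. (d k)\<^sup>2) \<longlonglongrightarrow> 0"
    proof (rule tendsto_sandwich[OF _ _ tendsto_const upper])
      show "\<forall>\<^sub>F k in sequentially. (d k)\<^sup>2 \<le> (\<delta> k - \<delta> (Suc k)) / a"
        using desc by eventually_elim (use \<open>0 < a\<close> in \<open>simp add: d_def field_simps\<close>)
    qed simp
    then have "(\<lambda>k. sqrt ((d k)\<^sup>2)) \<longlonglongrightarrow> sqrt 0" by (rule tendsto_real_sqrt)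
    then show ?thesis by (simp add: d_def)
  qed
  have V_lim: "V \<longlonglongrightarrow> 0"
  proof -
    have "(\<lambda>k. \<delta> (Suc k) powr (1 - q)) \<longlonglongrightarrow> 0"
    proof (rule tendsto_zero_powrI)
      show "(\<lambda>k. \<delta> (Suc k)) \<longlonglongrightarrow> 0" using lim by (rule LIMSEQ_Suc)
    next
      show "\<forall>\<^sub>F k in sequentially. 0 \<le> \<delta> (Suc k)"
        using pos[THEN eventually_sequentially_Suc[THEN iffD2]] by eventually_elim simp
    qed (use \<open>q < 1\<close> in \<open>auto intro: tendsto_const\<close>)
    then have "V \<longlonglongrightarrow> 0 + b / a * (M * 0)"
      unfolding V_def by (intro tendsto_intros d_lim)
    then show ?thesis by simp
  qed
  have "\<forall>\<^sub>F k in sequentially. V k < \<rho> / 2 \<and> 0 < \<delta> k \<and>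
      \<delta> (Suc k) + a * (norm (x (Suc k) - x k))\<^sup>2 \<le> \<delta> k \<and>
      (x (Suc k) \<in> ball xbar \<rho> \<longrightarrow>
      1 \<le> M * (1 - q) * \<delta> (Suc k) powr (- q) * (b * norm (x (Suc k) - x k)))"
    using order_tendstoD(2)[OF V_lim, of "\<rho> / 2"] \<open>0 < \<rho>\<close> pos desc PLK
    by (auto simp: eventually_conj_iff)
  then obtain N where N: "\<And>k. N \<le> k \<Longrightarrow> V k < \<rho> / 2"
    "\<And>k. N \<le> k \<Longrightarrow> 0 < \<delta> k"
    "\<And>k. N \<le> k \<Longrightarrow> \<delta> (Suc k) + a * (d k)\<^sup>2 \<le> \<delta> k"
    "\<And>k. N \<le> k \<Longrightarrow> x (Suc k) \<in> ball xbar \<rho> \<Longrightarrow>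
      1 \<le> M * (1 - q) * \<delta> (Suc k) powr (- q) * (b * d k)"
    unfolding eventually_sequentially d_def by blast
  have V_nonneg: "0 \<le> V k" for k
    using assms(1-3) by (simp add: V_def d_def)
  obtain m where m: "Suc N \<le> m" "dist (x m) xbar < \<rho> / 2"
    using acc[of "\<rho> / 2"] \<open>0 < \<rho>\<close> unfolding frequently_sequentially by auto
  then obtain n where n: "m = Suc n" "N \<le> n" by (cases m) auto
  have trapped: "dist (x (Suc k)) xbar + V k < \<rho>" if "n \<le> k" for k
    using that
  proof (induction k rule: dec_induct)
    case base
    show ?case using N(1)[OF n(2)] m n by simp
  next
    case (step k)
    have "x (Suc k) \<in> ball xbar \<rho>"
      using step.IH V_nonneg[of k] by (simp add: dist_commute)
    then have "2 * d (Suc k) \<le> d k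
        + b / a * (M * \<delta> (Suc k) powr (1 - q) - M * \<delta> (Suc (Suc k)) powr (1 - q))"
      using assms(1-5) N(2)[of "Suc (Suc k)"] N(3)[of "Suc k"] N(4)[of k] n step.hyps
      by (intro PLK_step_length) (auto simp: d_def)
    then have "d (Suc k) + V (Suc k) \<le> V k"
      by (simp add: V_def right_diff_distrib)
    moreover have "dist (x (Suc (Suc k))) xbar \<le> dist (x (Suc k)) xbar + d (Suc k)"
      using dist_triangle[of "x (Suc (Suc k))" xbar "x (Suc k)"] by (simp add: d_def dist_norm)
    ultimately show ?case using step.IH by linarith
  qed
  have "x k \<in> ball xbar \<rho>" if "Suc n \<le> k" for k
  proof -
    from that obtain j where "k = Suc j" "n \<le> j" by (cases k) auto
    then show ?thesis using trapped[of j] V_nonneg[of j] by (simp add: dist_commute)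
  qed
  then show ?thesis unfolding eventually_sequentially by blast
qed

text \<open>Only the product of the PLK bound and sufficient decrease matters for the rate: the
  former bounds \<open>\<delta> (k + 1) powr q\<close> by a multiple of the step length and the latter bounds the
  square of the step length by the decrease of \<open>\<delta>\<close>.\<close>

lemma PLK_scalar_recursion:
  fixes x :: "nat \<Rightarrow> 'a::real_normed_vector" and \<delta> :: "nat \<Rightarrow> real"
  assumes "0 < a" "0 < b" "0 < M" "0 \<le> q" "q < 1"
    and pos: "\<forall>\<^sub>F k in sequentially. 0 < \<delta> k"
    and lim: "\<delta> \<longlonglongrightarrow> 0"
    and desc: "\<forall>\<^sub>F k in sequentially. \<delta> (Suc k) + a * (norm (x (Suc k) - x k))\<^sup>2 \<le> \<delta> k"
    and PLK: "\<forall>\<^sub>F k in sequentially. x (Suc k) \<in> ball xbar \<rho> \<longrightarrow>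
      1 \<le> M * (1 - q) * \<delta> (Suc k) powr (- q) * (b * norm (x (Suc k) - x k))"
    and acc: "\<And>\<epsilon>. 0 < \<epsilon> \<Longrightarrow> \<exists>\<^sub>F k in sequentially. dist (x k) xbar < \<epsilon>"
    and "0 < \<rho>"
  obtains K where "0 < K"
    "\<forall>\<^sub>F k in sequentially. \<delta> (Suc k) powr (2 * q) \<le> K * (\<delta> k - \<delta> (Suc k))"
proof -
  define C where "C = M * (1 - q) * b"
  have "0 < C" using assms(1-5) by (simp add: C_def)
  have near: "\<forall>\<^sub>F k in sequentially. x k \<in> ball xbar \<rho>"
    using assms by (intro PLK_iterates_trapped[of a b M q \<delta> x xbar \<rho>])
  have "\<forall>\<^sub>F k in sequentially. x (Suc k) \<in> ball xbar \<rho>" "\<forall>\<^sub>F k in sequentially. 0 < \<delta> (Suc k)"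
    using near[THEN eventually_sequentially_Suc[THEN iffD2]]
      pos[THEN eventually_sequentially_Suc[THEN iffD2]] by simp_all
  then have "\<forall>\<^sub>F k in sequentially. \<delta> (Suc k) powr (2 * q) \<le> C\<^sup>2 / a * (\<delta> k - \<delta> (Suc k))"
    using PLK desc
  proof eventually_elim
    case (elim k)
    define t e where "t = \<delta> (Suc k)" and "e = norm (x (Suc k) - x k)"
    have "0 < t" using elim by (simp add: t_def)
    have "1 \<le> t powr (- q) * (C * e)"
      using elim by (simp add: t_def e_def C_def mult_ac)
    then have "t powr q * 1 \<le> t powr q * (t powr (- q) * (C * e))"
      by (intro mult_left_mono) auto
    also have "\<dots> = C * e"
      using \<open>0 < t\<close> by (simp add: powr_minus)
    finally have "(t powr q)\<^sup>2 \<le> (C * e)\<^sup>2"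
      by (intro power_mono) auto
    moreover have "(t powr q)\<^sup>2 = t powr (2 * q)"
      using \<open>0 < t\<close> by (simp add: power2_eq_square powr_add[symmetric])
    ultimately have "t powr (2 * q) \<le> C\<^sup>2 * e\<^sup>2" by (simp add: power_mult_distrib)
    also have "\<dots> \<le> C\<^sup>2 * ((\<delta> k - t) / a)"
      using elim \<open>0 < a\<close> by (intro mult_left_mono) (auto simp: t_def e_def field_simps)
    finally show ?case by (simp add: t_def)
  qed
  then show thesis using that[of "C\<^sup>2 / a"] \<open>0 < C\<close> \<open>0 < a\<close> by simp
qed

section \<open>Asymptotics of the scalar recursion\<close>

lemma recursion_zero_exponent:
  fixes \<delta> :: "nat \<Rightarrow> real"
  assumes pos: "\<forall>\<^sub>F k in sequentially. 0 < \<delta> k" and lim: "\<delta> \<longlonglongrightarrow> 0"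
    and rec: "\<forall>\<^sub>F k in sequentially. \<delta> (Suc k) powr 0 \<le> K * (\<delta> k - \<delta> (Suc k))"
  shows False
proof -
  have "(\<lambda>k. K * (\<delta> k - \<delta> (Suc k))) \<longlonglongrightarrow> K * (0 - 0)"
    using lim by (intro tendsto_intros LIMSEQ_Suc)
  then have "\<forall>\<^sub>F k in sequentially. K * (\<delta> k - \<delta> (Suc k)) < 1"
    by (rule order_tendstoD) simp
  moreover have "\<forall>\<^sub>F k in sequentially. 0 < \<delta> (Suc k)"
    using pos by (rule eventually_sequentially_Suc[THEN iffD2])
  ultimately have "\<forall>\<^sub>F k in sequentially. False"
    using rec by eventually_elim simp
  then show False by simp
qed

lemma recursion_superlinear:
  fixes \<delta> :: "nat \<Rightarrow> real"
  assumes pos: "\<forall>\<^sub>F k in sequentially. 0 < \<delta> k" and lim: "\<delta> \<longlonglongrightarrow> 0" and "0 < K" "p < 1"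
    and rec: "\<forall>\<^sub>F k in sequentially. \<delta> (Suc k) powr p \<le> K * (\<delta> k - \<delta> (Suc k))"
  shows "(\<lambda>k. \<delta> (Suc k) / \<delta> k) \<longlonglongrightarrow> 0"
proof -
  have pos_Suc: "\<forall>\<^sub>F k in sequentially. 0 < \<delta> (Suc k)"
    using pos by (rule eventually_sequentially_Suc[THEN iffD2])
  have "(\<lambda>k. \<delta> (Suc k) powr (1 - p)) \<longlonglongrightarrow> 0"
  proof (rule tendsto_zero_powrI)
    show "(\<lambda>k. \<delta> (Suc k)) \<longlonglongrightarrow> 0" using lim by (rule LIMSEQ_Suc)
  next
    show "\<forall>\<^sub>F k in sequentially. 0 \<le> \<delta> (Suc k)"
      using pos_Suc by eventually_elim simp
  qed (use \<open>p < 1\<close> in \<open>auto intro: tendsto_const\<close>)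
  then have upper: "(\<lambda>k. K * \<delta> (Suc k) powr (1 - p)) \<longlonglongrightarrow> 0"
    by (rule tendsto_mult_right_zero)
  show ?thesis
  proof (rule tendsto_sandwich[OF _ _ tendsto_const upper])
    show "\<forall>\<^sub>F k in sequentially. 0 \<le> \<delta> (Suc k) / \<delta> k"
      using pos pos_Suc by eventually_elim simp
    show "\<forall>\<^sub>F k in sequentially. \<delta> (Suc k) / \<delta> k \<le> K * \<delta> (Suc k) powr (1 - p)"
      using pos pos_Suc rec
    proof eventually_elim
      case (elim k)
      have "K * (\<delta> k - \<delta> (Suc k)) \<le> K * \<delta> k"
        using elim \<open>0 < K\<close> by (intro mult_left_mono) auto
      then have bound: "\<delta> (Suc k) powr p \<le> K * \<delta> k"
        using elim by linarith
      have "\<delta> (Suc k) = \<delta> (Suc k) powr p * \<delta> (Suc k) powr (1 - p)"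
        using elim by (simp add: powr_add[symmetric])
      also have "\<dots> \<le> (K * \<delta> k) * \<delta> (Suc k) powr (1 - p)"
        using bound by (rule mult_right_mono) simp
      finally show ?case using elim by (simp add: field_simps)
    qed
  qed
qed

lemma recursion_linear:
  fixes \<delta> :: "nat \<Rightarrow> real"
  assumes pos: "\<forall>\<^sub>F k in sequentially. 0 < \<delta> k" and "0 < K"
    and rec: "\<forall>\<^sub>F k in sequentially. \<delta> (Suc k) powr 1 \<le> K * (\<delta> k - \<delta> (Suc k))"
  shows "\<forall>\<^sub>F k in sequentially. \<delta> (Suc k) \<le> K / (1 + K) * \<delta> k"
proof -
  have "\<forall>\<^sub>F k in sequentially. 0 < \<delta> (Suc k)"
    using pos by (rule eventually_sequentially_Suc[THEN iffD2])
  then show ?thesis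
    using rec by eventually_elim (use \<open>0 < K\<close> in \<open>simp add: field_simps\<close>)
qed

text \<open>With \<open>\<alpha> = 1 / (p - 1)\<close>, the sequence \<open>\<eta> * k powr (- \<alpha>)\<close> is a supersolution of the recursion
  once \<open>\<eta>\<close> is large: its decrement is of order \<open>\<eta> * \<alpha> * k powr (- \<alpha> - 1)\<close>, while its power \<open>p\<close> is
  \<open>\<eta> powr p * k powr (- \<alpha> - 1)\<close> because \<open>\<alpha> * p = \<alpha> + 1\<close>, and \<open>p > 1\<close>. So \<open>\<delta>\<close>, once below it,
  cannot cross it.\<close>

lemma recursion_sublinear:
  fixes \<delta> :: "nat \<Rightarrow> real"
  assumes pos: "\<forall>\<^sub>F k in sequentially. 0 < \<delta> k" and "0 < K" "1 < p"
    and rec: "\<forall>\<^sub>F k in sequentially. \<delta> (Suc k) powr p \<le> K * (\<delta> k - \<delta> (Suc k))"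
  obtains \<eta> where "0 < \<eta>" "\<forall>\<^sub>F k in sequentially. \<delta> k \<le> \<eta> * real k powr (- (1 / (p - 1)))"
proof -
  define \<alpha> where "\<alpha> = 1 / (p - 1)"
  have "0 < \<alpha>" and \<alpha>: "(p - 1) * \<alpha> = 1" using \<open>1 < p\<close> by (simp_all add: \<alpha>_def)
  have \<alpha>p: "\<alpha> * p = \<alpha> + 1" using \<alpha> by (simp add: algebra_simps)
  obtain N0 where N0: "\<And>k. N0 \<le> k \<Longrightarrow> 0 < \<delta> k"
    "\<And>k. N0 \<le> k \<Longrightarrow> \<delta> (Suc k) powr p \<le> K * (\<delta> k - \<delta> (Suc k))"
    using eventually_conj[OF pos rec] unfolding eventually_sequentially by blast
  define N where "N = max 1 N0"
  have "1 \<le> N" "N0 \<le> N" by (simp_all add: N_def)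
  define L where "L = K * \<alpha> * 2 powr (\<alpha> + 1)"
  have "0 < L" using \<open>0 < K\<close> \<open>0 < \<alpha>\<close> by (simp add: L_def)
  \<comment> \<open>The first term makes the supersolution inequality hold, the second starts it above \<open>\<delta>\<close>.\<close>
  define \<eta> where "\<eta> = max (L powr \<alpha>) (\<delta> N * real N powr \<alpha>)"
  have "0 < \<eta>" using \<open>0 < L\<close> by (simp add: \<eta>_def less_max_iff_disj)
  have \<eta>_large: "L \<le> \<eta> powr (p - 1)"
  proof -
    have "L = (L powr \<alpha>) powr (p - 1)"
      using \<open>0 < L\<close> \<alpha> by (simp add: powr_powr mult.commute)
    also have "\<dots> \<le> \<eta> powr (p - 1)"
      using \<open>1 < p\<close> by (intro powr_mono2) (auto simp: \<eta>_def)
    finally show ?thesis .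
  qed
  have supersolution: "K * (\<eta> * real k powr (- \<alpha>) - \<eta> * real (Suc k) powr (- \<alpha>))
      \<le> (\<eta> * real (Suc k) powr (- \<alpha>)) powr p" if "1 \<le> k" for k
  proof -
    have "real k powr (- \<alpha> - 1) \<le> (real (Suc k) / 2) powr (- \<alpha> - 1)"
      using that \<open>0 < \<alpha>\<close> by (intro powr_mono2') auto
    also have "\<dots> = 2 powr (\<alpha> + 1) * real (Suc k) powr (- \<alpha> - 1)"
    proof -
      have "1 / 2 powr (- \<alpha> - 1) = 2 powr (\<alpha> + 1)"
        using powr_minus_divide[of 2 "- \<alpha> - 1"] by (simp add: add.commute)
      then show ?thesis by (simp add: powr_divide field_simps)
    qed
    finally have double: "real k powr (- \<alpha> - 1) \<le> 2 powr (\<alpha> + 1) * real (Suc k) powr (- \<alpha> - 1)" .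
    have "real k powr (- \<alpha>) - real (Suc k) powr (- \<alpha>) \<le> \<alpha> * real k powr (- \<alpha> - 1)"
      using powr_minus_convex_tangent[of "real k" "real (Suc k)" \<alpha>] that \<open>0 < \<alpha>\<close> by simp
    also have "\<dots> \<le> \<alpha> * (2 powr (\<alpha> + 1) * real (Suc k) powr (- \<alpha> - 1))"
      using double \<open>0 < \<alpha>\<close> by (intro mult_left_mono) auto
    finally have "(K * \<eta>) * (real k powr (- \<alpha>) - real (Suc k) powr (- \<alpha>))
        \<le> (K * \<eta>) * (\<alpha> * (2 powr (\<alpha> + 1) * real (Suc k) powr (- \<alpha> - 1)))"
      using \<open>0 < K\<close> \<open>0 < \<eta>\<close> by (intro mult_left_mono) auto
    also have "\<dots> = L * (\<eta> * real (Suc k) powr (- \<alpha> - 1))"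
      by (simp add: L_def)
    also have "\<dots> \<le> \<eta> powr (p - 1) * (\<eta> * real (Suc k) powr (- \<alpha> - 1))"
      using \<eta>_large \<open>0 < \<eta>\<close> by (intro mult_right_mono) auto
    also have "\<dots> = \<eta> powr p * real (Suc k) powr (- \<alpha> - 1)"
      using \<open>0 < \<eta>\<close> by (simp add: powr_diff)
    also have "\<dots> = (\<eta> * real (Suc k) powr (- \<alpha>)) powr p"
    proof -
      have "- \<alpha> - 1 = - \<alpha> * p" using \<alpha>p by simp
      then show ?thesis using \<open>0 < \<eta>\<close> by (simp add: powr_mult powr_powr)
    qed
    finally show ?thesis by (simp add: right_diff_distrib mult.assoc)
  qed
  have "\<delta> k \<le> \<eta> * real k powr (- \<alpha>)" if "N \<le> k" for k
    using that
  proof (induction k rule: dec_induct)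
    case base
    have "\<delta> N = (\<delta> N * real N powr \<alpha>) * real N powr (- \<alpha>)"
      using \<open>1 \<le> N\<close> by (simp add: powr_minus)
    also have "\<dots> \<le> \<eta> * real N powr (- \<alpha>)"
      by (intro mult_right_mono) (auto simp: \<eta>_def)
    finally show ?case .
  next
    case (step k)
    define B where "B = \<eta> * real (Suc k) powr (- \<alpha>)"
    have "0 \<le> B" using \<open>0 < \<eta>\<close> by (simp add: B_def)
    have "\<delta> (Suc k) \<le> B"
    proof (rule ccontr)
      assume "\<not> \<delta> (Suc k) \<le> B"
      then have above: "B < \<delta> (Suc k)" by simp
      have "B powr p < \<delta> (Suc k) powr p"
        using above \<open>0 \<le> B\<close> \<open>1 < p\<close> by (intro powr_less_mono2) auto
      also have "\<dots> \<le> K * (\<delta> k - \<delta> (Suc k))"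
        using N0(2) step.hyps \<open>N0 \<le> N\<close> by simp
      also have "\<dots> \<le> K * (\<eta> * real k powr (- \<alpha>) - B)"
        using \<open>0 < K\<close> step.IH above by (intro mult_left_mono) auto
      also have "\<dots> \<le> B powr p"
        using supersolution[of k] \<open>1 \<le> N\<close> step.hyps by (simp add: B_def)
      finally show False by simp
    qed
    then show ?case by (simp add: B_def)
  qed
  then have "\<forall>\<^sub>F k in sequentially. \<delta> k \<le> \<eta> * real k powr (- \<alpha>)"
    unfolding eventually_sequentially by blast
  then show thesis using that[of \<eta>] \<open>0 < \<eta>\<close> by (simp add: \<alpha>_def)
qed

section \<open>From the extended-real function to the scalar recursion\<close>

lemma nonincreasing_tendsto_if_subseq_tendsto:
  fixes s :: "nat \<Rightarrow> 'b::linorder_topology"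
  assumes mono: "\<And>i j. m \<le> i \<Longrightarrow> i \<le> j \<Longrightarrow> s j \<le> s i"
    and "strict_mono r" and lim: "(\<lambda>j. s (r j)) \<longlonglongrightarrow> L"
  shows "\<And>k. m \<le> k \<Longrightarrow> L \<le> s k" and "s \<longlonglongrightarrow> L"
proof -
  show lower: "L \<le> s k" if "m \<le> k" for k
  proof (rule LIMSEQ_le_const2[OF lim])
    have "s (r j) \<le> s k" if "k \<le> j" for j
      using mono[of k "r j"] seq_suble[OF \<open>strict_mono r\<close>, of j] \<open>m \<le> k\<close> that by simp
    then show "\<exists>n. \<forall>j\<ge>n. s (r j) \<le> s k" by blast
  qed
  show "s \<longlonglongrightarrow> L"
  proof (rule order_tendstoI)
    fix c assume "c < L"
    then show "\<forall>\<^sub>F k in sequentially. c < s k"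
      unfolding eventually_sequentially using lower by (meson less_le_trans)
  next
    fix c assume "L < c"
    then have "\<forall>\<^sub>F j in sequentially. s (r j) < c \<and> m \<le> j"
      using order_tendstoD(2)[OF lim] eventually_ge_at_top[of m] by (auto simp: eventually_conj_iff)
    then obtain j where j: "s (r j) < c" "m \<le> j"
      unfolding eventually_sequentially by blast
    have "m \<le> r j" using seq_suble[OF \<open>strict_mono r\<close>, of j] j by simp
    then have "s k < c" if "r j \<le> k" for k
      using mono[OF _ that] j by (meson le_less_trans)
    then show "\<forall>\<^sub>F k in sequentially. s k < c"
      unfolding eventually_sequentially by blast
  qed
qed

text \<open>Any subgradient bounds the distance from the origin to the subdifferential, so the PLK
  inequality may be read with the norm of an available subgradient.\<close>

lemma exponent_PLK_subgradient_bound: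
  assumes "exponent_PLK \<phi> xbar M q" "0 \<le> M" "q \<le> 1"
  obtains \<eta>\<^sub>0 \<rho> where "0 < \<eta>\<^sub>0" "0 < \<rho>"
    "\<And>y w. y \<in> ball xbar \<rho> \<Longrightarrow> \<phi> xbar < \<phi> y \<Longrightarrow> \<phi> y < \<phi> xbar + ereal \<eta>\<^sub>0 \<Longrightarrow>
      w \<in> limiting_subdiff \<phi> y \<Longrightarrow>
      1 \<le> M * (1 - q) * real_of_ereal (\<phi> y - \<phi> xbar) powr (- q) * norm w"
proof -
  obtain \<eta>\<^sub>0 U where \<eta>\<^sub>0: "0 < \<eta>\<^sub>0" and "open U" "xbar \<in> U"
    and PLK: "\<And>y. y \<in> U \<Longrightarrow> \<phi> xbar < \<phi> y \<Longrightarrow> \<phi> y < \<phi> xbar + ereal \<eta>\<^sub>0 \<Longrightarrow>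
      1 \<le> ereal (M * (1 - q) * real_of_ereal (\<phi> y - \<phi> xbar) powr (- q))
        * edist_set 0 (limiting_subdiff \<phi> y)"
    using assms(1) unfolding exponent_PLK_def by blast
  obtain \<rho> where \<rho>: "0 < \<rho>" "ball xbar \<rho> \<subseteq> U"
    using \<open>open U\<close> \<open>xbar \<in> U\<close> open_contains_ball by blast
  have "1 \<le> M * (1 - q) * real_of_ereal (\<phi> y - \<phi> xbar) powr (- q) * norm w"
    if y: "y \<in> ball xbar \<rho>" "\<phi> xbar < \<phi> y" "\<phi> y < \<phi> xbar + ereal \<eta>\<^sub>0"
      and w: "w \<in> limiting_subdiff \<phi> y" for y w
  proof -
    define G where "G = M * (1 - q) * real_of_ereal (\<phi> y - \<phi> xbar) powr (- q)"
    have "0 \<le> G" using assms by (simp add: G_def)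
    have "edist_set 0 (limiting_subdiff \<phi> y) \<le> ereal (norm w)"
      unfolding edist_set_def using INF_lower[OF w, of "\<lambda>y. ereal (dist 0 y)"] by simp
    then have "ereal G * edist_set 0 (limiting_subdiff \<phi> y) \<le> ereal G * ereal (norm w)"
      using \<open>0 \<le> G\<close> by (intro ereal_mult_left_mono) auto
    moreover have "1 \<le> ereal G * edist_set 0 (limiting_subdiff \<phi> y)"
      using PLK[of y] y \<rho>(2) unfolding G_def by blast
    ultimately have "1 \<le> ereal G * ereal (norm w)" by (rule order_trans[rotated])
    then show ?thesis by (simp add: G_def one_ereal_def)
  qed
  then show thesis using that \<eta>\<^sub>0 \<rho>(1) by blast
qed

lemma terminates_imp_converges_linearly:
  assumes "terminates_at s L" "\<bar>L\<bar> \<noteq> \<infinity>"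
  shows "converges_linearly s L"
proof -
  have "\<forall>\<^sub>F k in sequentially. s k = L" "\<forall>\<^sub>F k in sequentially. s (Suc k) = L"
    using assms(1)[unfolded terminates_at_def]
      assms(1)[unfolded terminates_at_def, THEN eventually_sequentially_Suc[THEN iffD2]]
    by simp_all
  then have "\<forall>\<^sub>F k in sequentially. \<bar>s (Suc k) - L\<bar> \<le> ereal (1 / 2) * \<bar>s k - L\<bar>"
    by eventually_elim (use assms(2) in simp)
  then show ?thesis
    unfolding converges_linearly_def by (intro exI[of _ "1 / 2"]) simp
qed

theorem theorem2:
  fixes \<phi> :: "real ^ 'n \<Rightarrow> ereal"
    and x :: "nat \<Rightarrow> real ^ 'n"
    and xbar :: "real ^ 'n"
    and a b M q :: real
    and r :: "nat \<Rightarrow> nat"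
  assumes "proper_fun \<phi>" and "lower_semicontinuous \<phi>" and "bounded_from_below \<phi>"
    and "a > 0" and "b > 0"
    and "\<And>k. k \<ge> 1 \<Longrightarrow> \<phi> (x (Suc k)) + ereal (a * (norm (x (Suc k) - x k))\<^sup>2) \<le> \<phi> (x k)"
    and "\<And>k. k \<ge> 1 \<Longrightarrow>
           \<exists>w \<in> limiting_subdiff \<phi> (x (Suc k)). norm w \<le> b * norm (x (Suc k) - x k)"
    and "xbar \<in> edom \<phi>"
    and "strict_mono r" and "(\<lambda>j. x (r j)) \<longlonglongrightarrow> xbar"
    and "(\<lambda>j. \<phi> (x (r j))) \<longlonglongrightarrow> \<phi> xbar"
    and "M > 0" and "0 \<le> q" and "q < 1"
    and "exponent_PLK \<phi> xbar M q"
  shows "(q = 0 \<longrightarrow> terminates_at (\<lambda>k. \<phi> (x k)) (\<phi> xbar)) \<and>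
         (0 < q \<and> q < 1/2 \<longrightarrow>
            terminates_at (\<lambda>k. \<phi> (x k)) (\<phi> xbar) \<or>
            converges_superlinearly (\<lambda>k. \<phi> (x k)) (\<phi> xbar)) \<and>
         (q = 1/2 \<longrightarrow> converges_linearly (\<lambda>k. \<phi> (x k)) (\<phi> xbar)) \<and>
         (1/2 < q \<and> q < 1 \<longrightarrow>
            (\<exists>\<eta>::real. \<eta> > 0 \<and>
              (\<forall>\<^sub>F k in sequentially.
                 \<phi> (x k) - \<phi> xbar \<le> ereal (\<eta> * real k powr (- (1 / (2 * q - 1)))))))"
proof -
  define L where "L = real_of_ereal (\<phi> xbar)"
  have L: "\<phi> xbar = ereal L"
    using assms(1,8) unfolding L_def proper_fun_def edom_def
    by (cases "\<phi> xbar") auto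
  have antimono: "\<phi> (x j) \<le> \<phi> (x i)" if "1 \<le> i" "i \<le> j" for i j
    using that(2)
  proof (induction j rule: dec_induct)
    case (step j)
    have "\<phi> (x (Suc j)) \<le> \<phi> (x (Suc j)) + ereal (a * (norm (x (Suc j) - x j))\<^sup>2)"
      using assms(4) by (cases "\<phi> (x (Suc j))") auto
    also have "\<dots> \<le> \<phi> (x j)" using assms(6)[of j] that step.hyps by simp
    finally show ?case using step.IH by simp
  qed simp
  have lower: "\<phi> xbar \<le> \<phi> (x k)" if "1 \<le> k" for k
    using nonincreasing_tendsto_if_subseq_tendsto(1)
      [of 1 "\<lambda>k. \<phi> (x k)", OF antimono assms(9,11) that] .
  have lim: "(\<lambda>k. \<phi> (x k)) \<longlonglongrightarrow> \<phi> xbar"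
    using nonincreasing_tendsto_if_subseq_tendsto(2)[of 1 "\<lambda>k. \<phi> (x k)", OF antimono assms(9,11)] .
  show ?thesis
  proof (cases "\<exists>k\<ge>1. \<phi> (x k) = \<phi> xbar")
    case True
    then obtain m where m: "1 \<le> m" "\<phi> (x m) = \<phi> xbar" by blast
    have "\<phi> (x k) = \<phi> xbar" if "m \<le> k" for k
      using antimono[OF m(1) that] lower[of k] m that by simp
    then have stationary: "terminates_at (\<lambda>k. \<phi> (x k)) (\<phi> xbar)"
      unfolding terminates_at_def eventually_sequentially by blast
    moreover have "converges_linearly (\<lambda>k. \<phi> (x k)) (\<phi> xbar)"
      using stationary by (rule terminates_imp_converges_linearly) (simp add: L)
    moreover have "\<forall>\<^sub>F k in sequentially.
        \<phi> (x k) - \<phi> xbar \<le> ereal (1 * real k powr (- (1 / (2 * q - 1))))"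
      using stationary unfolding terminates_at_def by eventually_elim (simp add: L)
    ultimately show ?thesis using zero_less_one by blast
  next
    case False
    then have above: "\<phi> xbar < \<phi> (x k)" if "1 \<le> k" for k
      using lower[OF that] that by (metis order_le_imp_less_or_eq)
    define \<delta> where "\<delta> = (\<lambda>k. real_of_ereal (\<phi> (x k) - \<phi> xbar))"
    \<comment> \<open>The value at index 1 may be infinite; from index 2 on a subgradient exists, so the
      value is finite.\<close>
    have fin: "\<phi> (x k) = ereal (L + \<delta> k)" "0 < \<delta> k" if "2 \<le> k" for k
    proof -
      obtain j where "k = Suc j" "1 \<le> j" using \<open>2 \<le> k\<close> by (cases k) auto
      then have "\<phi> (x k) < \<infinity>"
        using assms(7)[of j] unfolding limiting_subdiff_def edom_def by blast
      then show "\<phi> (x k) = ereal (L + \<delta> k)" "0 < \<delta> k"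
        using above[of k] that by (cases "\<phi> (x k)"; simp add: \<delta>_def L)+
    qed
    have pos: "\<forall>\<^sub>F k in sequentially. 0 < \<delta> k"
      using fin(2) unfolding eventually_sequentially by blast
    have \<delta>_lim: "\<delta> \<longlonglongrightarrow> 0"
    proof -
      have "\<forall>\<^sub>F k in sequentially. \<phi> (x k) = ereal (L + \<delta> k)"
        using fin(1) unfolding eventually_sequentially by blast
      then have "(\<lambda>k. ereal (L + \<delta> k)) \<longlonglongrightarrow> ereal L"
        using lim[unfolded L] by (rule Lim_transform_eventually[rotated])
      then have "(\<lambda>k. L + \<delta> k) \<longlonglongrightarrow> L" by simp
      then have "(\<lambda>k. L + \<delta> k - L) \<longlonglongrightarrow> L - L"
        by (intro tendsto_diff tendsto_const)
      then show ?thesis by simp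
    qed
    have desc: "\<forall>\<^sub>F k in sequentially. \<delta> (Suc k) + a * (norm (x (Suc k) - x k))\<^sup>2 \<le> \<delta> k"
      using eventually_ge_at_top[of 2]
    proof eventually_elim
      case (elim k)
      then show ?case using assms(6)[of k] fin(1)[of k] fin(1)[of "Suc k"] by simp
    qed
    obtain \<eta>\<^sub>0 \<rho> where "0 < \<eta>\<^sub>0" "0 < \<rho>" and subgrad:
      "\<And>y w. y \<in> ball xbar \<rho> \<Longrightarrow> \<phi> xbar < \<phi> y \<Longrightarrow> \<phi> y < \<phi> xbar + ereal \<eta>\<^sub>0 \<Longrightarrow>
        w \<in> limiting_subdiff \<phi> y \<Longrightarrow>
        1 \<le> M * (1 - q) * real_of_ereal (\<phi> y - \<phi> xbar) powr (- q) * norm w"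
      using exponent_PLK_subgradient_bound[OF assms(15)] assms(12,14) by (metis less_imp_le)
    have "\<forall>\<^sub>F k in sequentially. \<delta> (Suc k) < \<eta>\<^sub>0"
      using order_tendstoD(2)[OF LIMSEQ_Suc[OF \<delta>_lim] \<open>0 < \<eta>\<^sub>0\<close>] .
    then have PLK: "\<forall>\<^sub>F k in sequentially. x (Suc k) \<in> ball xbar \<rho> \<longrightarrow>
        1 \<le> M * (1 - q) * \<delta> (Suc k) powr (- q) * (b * norm (x (Suc k) - x k))"
      using eventually_ge_at_top[of 1]
    proof eventually_elim
      case (elim k)
      obtain w where w: "w \<in> limiting_subdiff \<phi> (x (Suc k))"
        "norm w \<le> b * norm (x (Suc k) - x k)"
        using assms(7)[of k] elim by blast
      have "1 \<le> M * (1 - q) * \<delta> (Suc k) powr (- q) * norm w" if "x (Suc k) \<in> ball xbar \<rho>"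
        using subgrad[OF that _ _ w(1)] above[of "Suc k"] fin(1)[of "Suc k"] elim
        by (simp add: \<delta>_def[symmetric] L)
      moreover have "M * (1 - q) * \<delta> (Suc k) powr (- q) * norm w
          \<le> M * (1 - q) * \<delta> (Suc k) powr (- q) * (b * norm (x (Suc k) - x k))"
        using w(2) assms(12,14) by (intro mult_left_mono) auto
      ultimately show ?case by (blast intro: order_trans)
    qed
    have acc: "\<exists>\<^sub>F k in sequentially. dist (x k) xbar < \<epsilon>" if "0 < \<epsilon>" for \<epsilon>
      unfolding frequently_sequentially
    proof
      fix N
      have "\<forall>\<^sub>F j in sequentially. dist (x (r j)) xbar < \<epsilon> \<and> N \<le> j"
        using tendstoD[OF assms(10) that] eventually_ge_at_top[of N]
        by (auto simp: eventually_conj_iff)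
      then obtain j where "dist (x (r j)) xbar < \<epsilon>" "N \<le> j"
        unfolding eventually_sequentially by blast
      then show "\<exists>k\<ge>N. dist (x k) xbar < \<epsilon>"
        using seq_suble[OF assms(9), of j] by (meson order_trans)
    qed
    obtain K where "0 < K" and rec:
      "\<forall>\<^sub>F k in sequentially. \<delta> (Suc k) powr (2 * q) \<le> K * (\<delta> k - \<delta> (Suc k))"
      using PLK_scalar_recursion[OF assms(4,5,12,13,14) pos \<delta>_lim desc PLK acc \<open>0 < \<rho>\<close>] by blast
    have zero: "q \<noteq> 0"
      using recursion_zero_exponent[OF pos \<delta>_lim] rec by auto
    have superlinear: "converges_superlinearly (\<lambda>k. \<phi> (x k)) (\<phi> xbar)" if "q < 1 / 2"
    proof -
      have "(\<lambda>k. \<delta> (Suc k) / \<delta> k) \<longlonglongrightarrow> 0"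
        using recursion_superlinear[OF pos \<delta>_lim \<open>0 < K\<close> _ rec] that by simp
      then have "(\<lambda>k. ereal (\<delta> (Suc k) / \<delta> k)) \<longlonglongrightarrow> 0"
        by (simp add: zero_ereal_def)
      moreover have "\<forall>\<^sub>F k in sequentially. ereal (\<delta> (Suc k) / \<delta> k)
          = (\<phi> (x (Suc k)) - \<phi> xbar) / (\<phi> (x k) - \<phi> xbar)"
        using eventually_ge_at_top[of 2]
      proof eventually_elim
        case (elim k)
        then show ?case using fin[of k] fin[of "Suc k"] by (simp add: L)
      qed
      ultimately have "(\<lambda>k. (\<phi> (x (Suc k)) - \<phi> xbar) / (\<phi> (x k) - \<phi> xbar)) \<longlonglongrightarrow> 0"
        by (rule Lim_transform_eventually)
      then show ?thesis
        unfolding converges_superlinearly_def using lim False by blast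
    qed
    have linear: "converges_linearly (\<lambda>k. \<phi> (x k)) (\<phi> xbar)" if "q = 1 / 2"
    proof -
      have "\<forall>\<^sub>F k in sequentially. \<delta> (Suc k) \<le> K / (1 + K) * \<delta> k"
        using recursion_linear[OF pos \<open>0 < K\<close>] rec that by simp
      then have "\<forall>\<^sub>F k in sequentially.
          \<bar>\<phi> (x (Suc k)) - \<phi> xbar\<bar> \<le> ereal (K / (1 + K)) * \<bar>\<phi> (x k) - \<phi> xbar\<bar>"
        using eventually_ge_at_top[of 2]
      proof eventually_elim
        case (elim k)
        then show ?case using fin[of k] fin[of "Suc k"] by (simp add: L)
      qed
      then show ?thesis
        unfolding converges_linearly_def using \<open>0 < K\<close>
        by (intro exI[of _ "K / (1 + K)"]) simp
    qed
    have sublinear: "\<exists>\<eta>::real. \<eta> > 0 \<and> (\<forall>\<^sub>F k in sequentially.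
        \<phi> (x k) - \<phi> xbar \<le> ereal (\<eta> * real k powr (- (1 / (2 * q - 1)))))" if "1 / 2 < q"
    proof -
      have "1 < 2 * q" using that by simp
      then obtain \<eta> where "0 < \<eta>" and
        "\<forall>\<^sub>F k in sequentially. \<delta> k \<le> \<eta> * real k powr (- (1 / (2 * q - 1)))"
        using recursion_sublinear[OF pos \<open>0 < K\<close> _ rec] by blast
      from this(2) have "\<forall>\<^sub>F k in sequentially.
          \<phi> (x k) - \<phi> xbar \<le> ereal (\<eta> * real k powr (- (1 / (2 * q - 1))))"
        using eventually_ge_at_top[of 2]
      proof eventually_elim
        case (elim k)
        then show ?case using fin(1)[of k] by (simp add: L)
      qed
      with \<open>0 < \<eta>\<close> show ?thesis by blast
    qed
    show ?thesis using zero superlinear linear sublinear by blast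
  qed
qed

end
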